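(* Let $\mathbb{F}\in\{\mathbb{R},\mathbb{C}\}$ and $p,q,r\in[1,\infty]$. Then $\lVert\mu_{l,m,n}\rVert_{p,q,r}$ is uniformly bounded over all $l,m,n\in\mathbb{N}$ (i.e. $\sup_{l,m,n\in\mathbb{N}}\lVert\mu_{l,m,n}\rVert_{p,q,r}<\infty$) if and only if \[ (p,q,r)\in\{(1,2,\infty),\ (\infty,1,2),\ (2,\infty,1)\}. \]
   Context: For a matrix $A\in\mathbb{F}^{a\times b}$ and $s,t\in[1,\infty]$, $\lVert A\rVert_{s,t}\coloneqq\max_{x\neq 0}\lVert Ax\rVert_t/\lVert x\rVert_s$, with $\lVert\cdot\rVert_s$ the vector $\ell^s$-norm. For $l,m,n\in\mathbb{N}$, $\lVert\mu_{l,m,n}\rVert_{p,q,r}\coloneqq\max_{X,Y,M\neq0}\frac{|\operatorname{tr}(XMY)|}{\|X\|_{p,q}\|Y\|_{q,r}\|M\|_{r,p}}$, the maximum being over nonzero $X\in\mathbb{F}^{l\times m}$, $M\in\mathbb{F}^{m\times n}$, $Y\in\mathbb{F}^{n\times l}$. *)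

theory Defs
  imports Complex_Main "HOL-Library.Extended_Real" "Jordan_Normal_Form.Matrix"
begin

definition lp_norm :: "ereal \<Rightarrow> 'a::real_normed_field vec \<Rightarrow> real" where
  "lp_norm s x =
     (if s = \<infinity> then Max ((\<lambda>i. norm (x $ i)) ` {..<dim_vec x})
      else (\<Sum>i<dim_vec x. norm (x $ i) powr real_of_ereal s) powr (1 / real_of_ereal s))"

definition mat_trace :: "'a::comm_monoid_add mat \<Rightarrow> 'a" where
  "mat_trace A = (\<Sum>i<dim_row A. A $$ (i, i))"

text \<open>The two maxima below are rendered as real suprema. The sets are nonempty for positive
  dimensions and bounded, see \<open>bdd_above_op_norm\<close> and \<open>bdd_above_mu_norm\<close>.\<close>

definition op_norm :: "ereal \<Rightarrow> ereal \<Rightarrow> 'a::real_normed_field mat \<Rightarrow> real" where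
  "op_norm s t A =
     Sup {lp_norm t (A *\<^sub>v x) / lp_norm s x | x. x \<in> carrier_vec (dim_col A) \<and> x \<noteq> 0\<^sub>v (dim_col A)}"

text \<open>The argument of type \<^typ>\<open>'a itself\<close> selects the ground field.\<close>

definition mu_norm ::
  "'a::real_normed_field itself \<Rightarrow> ereal \<Rightarrow> ereal \<Rightarrow> ereal \<Rightarrow> nat \<Rightarrow> nat \<Rightarrow> nat \<Rightarrow> real" where
  "mu_norm _ p q r l m n =
     Sup {norm (mat_trace (X * M * Y)) / (op_norm p q X * op_norm q r Y * op_norm r p M) |
          (X :: 'a mat) Y M.
            X \<in> carrier_mat l m \<and> X \<noteq> 0\<^sub>m l m \<and>
            Y \<in> carrier_mat n l \<and> Y \<noteq> 0\<^sub>m n l \<and>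
            M \<in> carrier_mat m n \<and> M \<noteq> 0\<^sub>m m n}"

lemma norm_le_lp_norm:
  assumes "1 \<le> s" "i < dim_vec x"
  shows "norm (x $ i) \<le> lp_norm s x"
proof (cases "s = \<infinity>")
  case True
  then show ?thesis using assms by (auto simp: lp_norm_def intro!: Max_ge)
next
  case False
  then obtain u where u: "s = ereal u" "u \<ge> 1" using assms by (cases s) auto
  have "norm (x $ i) powr u \<le> (\<Sum>i<dim_vec x. norm (x $ i) powr u)"
    using assms by (intro member_le_sum) auto
  then have "(norm (x $ i) powr u) powr (1/u) \<le> (\<Sum>i<dim_vec x. norm (x $ i) powr u) powr (1/u)"
    using u by (intro powr_mono2) auto
  then show ?thesis using u by (simp add: lp_norm_def powr_powr)
qed

lemma lp_norm_le:
  assumes "1 \<le> s" "0 < dim_vec x" "\<And>i. i < dim_vec x \<Longrightarrow> norm (x $ i) \<le> K"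
  shows "lp_norm s x \<le> real (dim_vec x) * K"
proof -
  have K0: "0 \<le> K" using assms(2) assms(3)[of 0] norm_ge_zero order_trans by blast
  have d1: "1 \<le> real (dim_vec x)" using assms by simp
  show ?thesis
  proof (cases "s = \<infinity>")
    case True
    have "Max ((\<lambda>i. norm (x $ i)) ` {..<dim_vec x}) \<le> K"
      using assms by (intro Max.boundedI) auto
    then have "lp_norm s x \<le> K" using True by (simp add: lp_norm_def)
    also have "\<dots> \<le> real (dim_vec x) * K" using mult_right_mono[OF d1 K0] by simp
    finally show ?thesis .
  next
    case False
    then obtain u where u: "s = ereal u" "u \<ge> 1" using assms by (cases s) auto
    have "(\<Sum>i<dim_vec x. norm (x $ i) powr u) \<le> (\<Sum>i<dim_vec x. K powr u)"
      using assms u by (intro sum_mono powr_mono2) auto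
    then have "lp_norm s x \<le> (real (dim_vec x) * K powr u) powr (1/u)"
      using u by (auto simp: lp_norm_def intro!: powr_mono2 sum_nonneg)
    also have "\<dots> = real (dim_vec x) powr (1/u) * K"
      using u K0 by (simp add: powr_mult powr_powr)
    also have "\<dots> \<le> real (dim_vec x) powr 1 * K"
      using u d1 K0 by (intro mult_right_mono powr_mono) auto
    finally show ?thesis using d1 by simp
  qed
qed

lemma lp_norm_pos:
  assumes "1 \<le> s" "x \<in> carrier_vec n" "x \<noteq> 0\<^sub>v n"
  shows "0 < lp_norm s x"
proof -
  obtain i where "i < n" "x $ i \<noteq> 0" using assms by (metis carrier_vecD eq_vecI index_zero_vec)
  then show ?thesis using norm_le_lp_norm[of s i x] assms
    by (smt (verit) carrier_vecD zero_less_norm_iff)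
qed

lemma lp_norm_unit_vec:
  assumes "1 \<le> s" "j < n"
  shows "lp_norm s (unit_vec n j :: 'a::real_normed_field vec) = 1"
proof (cases "s = \<infinity>")
  case True
  have "Max ((\<lambda>i. norm ((unit_vec n j :: 'a vec) $ i)) ` {..<n}) = 1"
    using assms(2) by (intro Max_eqI) (auto simp: unit_vec_def image_iff intro!: bexI[of _ j])
  then show ?thesis using True by (simp add: lp_norm_def)
next
  case False
  then obtain u where u: "s = ereal u" "u \<ge> 1" using assms by (cases s) auto
  have "(\<Sum>i<n. norm ((unit_vec n j :: 'a vec) $ i) powr u) = (\<Sum>i<n. if i = j then 1 else 0)"
    by (intro sum.cong) (auto simp: unit_vec_def)
  then show ?thesis using u assms by (simp add: lp_norm_def)
qed

lemma bdd_above_op_norm: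
  fixes A :: "'a::real_normed_field mat"
  assumes "1 \<le> s" "1 \<le> t" "0 < dim_row A"
  shows "bdd_above {lp_norm t (A *\<^sub>v x) / lp_norm s x | x.
           x \<in> carrier_vec (dim_col A) \<and> x \<noteq> 0\<^sub>v (dim_col A)}"
proof (rule bdd_aboveI)
  define C where "C = (\<Sum>i<dim_row A. \<Sum>j<dim_col A. norm (A $$ (i,j)))"
  fix z assume "z \<in> {lp_norm t (A *\<^sub>v x) / lp_norm s x | x.
           x \<in> carrier_vec (dim_col A) \<and> x \<noteq> 0\<^sub>v (dim_col A)}"
  then obtain x where x: "x \<in> carrier_vec (dim_col A)" "x \<noteq> 0\<^sub>v (dim_col A)"
    and z: "z = lp_norm t (A *\<^sub>v x) / lp_norm s x" by blast
  have pos: "0 < lp_norm s x" using lp_norm_pos[OF assms(1) x] .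
  have "norm ((A *\<^sub>v x) $ i) \<le> C * lp_norm s x" if i: "i < dim_row A" for i
  proof -
    have "norm ((A *\<^sub>v x) $ i) = norm (\<Sum>j<dim_col A. A $$ (i,j) * x $ j)"
      using i x by (simp add: scalar_prod_def atLeast0LessThan)
    also have "\<dots> \<le> (\<Sum>j<dim_col A. norm (A $$ (i,j)) * lp_norm s x)"
      using x assms
      by (intro sum_norm_le) (auto simp: norm_mult intro!: mult_left_mono norm_le_lp_norm)
    also have "\<dots> = (\<Sum>j<dim_col A. norm (A $$ (i,j))) * lp_norm s x"
      by (simp add: sum_distrib_right)
    also have "\<dots> \<le> C * lp_norm s x"
      using i pos unfolding C_def
      by (intro mult_right_mono
            member_le_sum[where f = "\<lambda>i. \<Sum>j<dim_col A. norm (A $$ (i,j))"])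
         (auto intro: sum_nonneg)
    finally show ?thesis .
  qed
  then have "lp_norm t (A *\<^sub>v x) \<le> real (dim_row A) * (C * lp_norm s x)"
    using lp_norm_le[of t "A *\<^sub>v x" "C * lp_norm s x"] assms by simp
  then show "z \<le> real (dim_row A) * C" using pos z by (simp add: pos_divide_le_eq mult.assoc)
qed

lemma norm_entry_le_op_norm:
  fixes A :: "'a::real_normed_field mat"
  assumes "1 \<le> s" "1 \<le> t" "i < dim_row A" "j < dim_col A"
  shows "norm (A $$ (i,j)) \<le> op_norm s t A"
proof -
  let ?e = "unit_vec (dim_col A) j :: 'a vec"
  have e0: "?e \<noteq> 0\<^sub>v (dim_col A)"
    using assms(4) by (metis index_unit_vec(1) index_zero_vec(1) zero_neq_one)
  have "norm (A $$ (i,j)) = norm ((A *\<^sub>v ?e) $ i)"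
    using assms by simp
  also have "\<dots> \<le> lp_norm t (A *\<^sub>v ?e)" using assms by (intro norm_le_lp_norm) auto
  also have "\<dots> = lp_norm t (A *\<^sub>v ?e) / lp_norm s ?e"
    using lp_norm_unit_vec[OF assms(1,4), where 'a = 'a] by simp
  also have "\<dots> \<le> op_norm s t A"
    unfolding op_norm_def using bdd_above_op_norm[of s t A] assms e0
    by (intro cSup_upper) auto
  finally show ?thesis .
qed

lemma op_norm_pos:
  assumes "1 \<le> s" "1 \<le> t" "A \<in> carrier_mat a b" "A \<noteq> 0\<^sub>m a b"
  shows "0 < op_norm s t A"
proof -
  obtain i j where "i < a" "j < b" "A $$ (i,j) \<noteq> 0"
    using assms(3,4) by (metis carrier_matD eq_matI index_zero_mat)
  then show ?thesis using norm_entry_le_op_norm[of s t i A j] assms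
    by (smt (verit) carrier_matD zero_less_norm_iff)
qed

lemma bdd_above_mu_norm:
  assumes "1 \<le> p" "1 \<le> q" "1 \<le> r"
  shows "bdd_above
    {norm (mat_trace (X * M * Y)) / (op_norm p q X * op_norm q r Y * op_norm r p M) |
          (X :: 'a::real_normed_field mat) Y M.
            X \<in> carrier_mat l m \<and> X \<noteq> 0\<^sub>m l m \<and>
            Y \<in> carrier_mat n l \<and> Y \<noteq> 0\<^sub>m n l \<and>
            M \<in> carrier_mat m n \<and> M \<noteq> 0\<^sub>m m n}"
proof (rule bdd_aboveI, clarify)
  fix X Y M :: "'a mat"
  assume X: "X \<in> carrier_mat l m" "X \<noteq> 0\<^sub>m l m" and Y: "Y \<in> carrier_mat n l" "Y \<noteq> 0\<^sub>m n l"
    and M: "M \<in> carrier_mat m n" "M \<noteq> 0\<^sub>m m n"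
  define x y z where "x = op_norm p q X" and "y = op_norm q r Y" and "z = op_norm r p M"
  have pos: "0 < x" "0 < y" "0 < z"
    using op_norm_pos X Y M assms unfolding x_def y_def z_def by blast+
  have "mat_trace (X * M * Y) = (\<Sum>i<l. \<Sum>k<n. (\<Sum>j<m. X $$ (i,j) * M $$ (j,k)) * Y $$ (k,i))"
    unfolding mat_trace_def using X Y M
    by (auto simp: times_mat_def[of "X * M"] scalar_prod_def atLeast0LessThan intro!: sum.cong)
  also have "norm \<dots> \<le> (\<Sum>i<l. \<Sum>k<n. (\<Sum>j<m. x * z) * y)"
  proof (intro sum_norm_le)
    fix i k assume "i \<in> {..<l}" "k \<in> {..<n}"
    then have ik: "i < l" "k < n" by auto
    have "norm (X $$ (i,j) * M $$ (j,k)) \<le> x * z" if "j < m" for j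
      unfolding norm_mult x_def z_def
      using that ik X M assms pos(1) x_def
      by (intro mult_mono norm_entry_le_op_norm) auto
    then have "norm (\<Sum>j<m. X $$ (i,j) * M $$ (j,k)) \<le> (\<Sum>j<m. x * z)"
      by (intro sum_norm_le) auto
    moreover have "norm (Y $$ (k,i)) \<le> y"
      unfolding y_def using ik Y assms by (intro norm_entry_le_op_norm) auto
    ultimately show "norm ((\<Sum>j<m. X $$ (i,j) * M $$ (j,k)) * Y $$ (k,i)) \<le> (\<Sum>j<m. x * z) * y"
      unfolding norm_mult using pos by (intro mult_mono) (auto intro: sum_nonneg)
  qed
  also have "\<dots> = real (l * m * n) * (x * y * z)" by simp
  finally have "norm (mat_trace (X * M * Y)) \<le> real (l * m * n) * (x * y * z)" .
  moreover have "0 < x * y * z" using pos by simp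
  ultimately have "norm (mat_trace (X * M * Y)) / (x * y * z) \<le> real (l * m * n)"
    by (simp add: pos_divide_le_eq)
  then show "norm (mat_trace (X * M * Y)) / (op_norm p q X * op_norm q r Y * op_norm r p M)
      \<le> real (l * m * n)"
    by (simp add: x_def y_def z_def)
qed

end

theory Submission
  imports Defs "HOL-Analysis.Convex"
begin

text \<open>For \<open>(1, 2, \<infinity>)\<close> boundedness is Grothendieck's inequality, and the other two triples follow by
  cyclicity of the trace. Grothendieck's inequality is obtained by truncating Rademacher sums: the
  best constant \<open>\<Gamma>\<close> over all unit vectors satisfies \<open>\<Gamma> \<le> 4 B + \<Gamma> / 2\<close>, where \<open>B\<close> is the norm of the
  matrix from \<open>\<ell>\<^sup>\<infinity>\<close> to \<open>\<ell>\<^sup>1\<close>.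

  Conversely, three identity matrices of size \<open>N\<close> have trace \<open>N\<close>, while the product of their norms
  is \<open>N\<close> to the power of the spread of \<open>1/p\<close>, \<open>1/q\<close>, \<open>1/r\<close>. So the spread is 1, and up to a
  cyclic shift the triple is \<open>(1, q, \<infinity>)\<close> or \<open>(\<infinity>, q, 1)\<close>. Taking two of the matrices to be Hadamard
  matrices and the third the identity gives trace \<open>N\<^sup>2\<close>, which is too large unless the triple is
  \<open>(1, 2, \<infinity>)\<close>.

  Real and complex scalars are treated together, as the fields that are also real inner product
  spaces.\<close>

subsection \<open>Grothendieck's inequality\<close>

lemma sum_lessThan_double:
  fixes f :: "nat \<Rightarrow> 'b::comm_monoid_add"
  shows "(\<Sum>i<2 * n. f i) = (\<Sum>i<n. f (2 * i) + f (2 * i + 1))"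
  by (induction n) (simp_all add: ac_simps)

text \<open>Splitting indices by their lowest binary digit drives the inductions for both Rademacher
  sums and Hadamard matrices.\<close>

lemma sum_lessThan_power_Suc:
  fixes f :: "nat \<Rightarrow> 'b::comm_monoid_add"
  shows "(\<Sum>i<2 ^ Suc k. f i) = (\<Sum>i<2 ^ k. f (2 * i) + f (2 * i + 1))"
  using sum_lessThan_double[of f "2 ^ k"] by simp

lemma parallelogram:
  fixes a b :: "'a::real_inner"
  shows "(norm (a + b))\<^sup>2 + (norm (a - b))\<^sup>2 = 2 * (norm a)\<^sup>2 + 2 * (norm b)\<^sup>2"
  by (simp add: power2_norm_eq_inner inner_add inner_diff inner_commute)

text \<open>With \<open>c\<close> the inner product of \<open>a\<close> and \<open>b\<close>,
  squaring and adding cancels the terms linear in \<open>c\<close>. Cauchy-Schwarz turns the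
  remaining \<open>8 * c^2\<close> into a mixed term, and 4 + 8 = 12.\<close>

lemma fourth_power_parallelogram:
  fixes a b :: "'a::real_inner"
  shows "(norm (a + b)) ^ 4 + (norm (a - b)) ^ 4
    \<le> 2 * (norm a) ^ 4 + 12 * (norm a)\<^sup>2 * (norm b)\<^sup>2 + 2 * (norm b) ^ 4"
proof -
  define c where "c = inner a b"
  have p: "(norm (a + b))\<^sup>2 = (norm a)\<^sup>2 + (norm b)\<^sup>2 + 2 * c"
    and m: "(norm (a - b))\<^sup>2 = (norm a)\<^sup>2 + (norm b)\<^sup>2 - 2 * c"
    unfolding c_def by (simp_all add: power2_norm_eq_inner inner_add inner_diff inner_commute)
  have "c\<^sup>2 \<le> (norm a)\<^sup>2 * (norm b)\<^sup>2"
    unfolding c_def power2_norm_eq_inner by (rule Cauchy_Schwarz_ineq)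
  moreover have "(norm (a + b)) ^ 4 + (norm (a - b)) ^ 4
      = ((norm (a + b))\<^sup>2)\<^sup>2 + ((norm (a - b))\<^sup>2)\<^sup>2" by (simp flip: power_mult)
  moreover have "\<dots> = 2 * ((norm a)\<^sup>2)\<^sup>2 + 4 * (norm a)\<^sup>2 * (norm b)\<^sup>2 + 2 * ((norm b)\<^sup>2)\<^sup>2 + 8 * c\<^sup>2"
    unfolding p m by (simp add: power2_eq_square algebra_simps)
  ultimately show ?thesis by (simp flip: power_mult)
qed

text \<open>\<open>rademacher_sum l x w\<close> is the signed sum of \<open>x 0, \<dots>, x (l - 1)\<close> whose signs are read off
  the last \<open>l\<close> binary digits of \<open>w\<close>.\<close>

fun rademacher_sum :: "nat \<Rightarrow> (nat \<Rightarrow> 'a::ab_group_add) \<Rightarrow> nat \<Rightarrow> 'a" where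
  "rademacher_sum 0 x w = 0"
| "rademacher_sum (Suc l) x w =
     (if even w then rademacher_sum l x (w div 2) + x l else rademacher_sum l x (w div 2) - x l)"

text \<open>Orthogonality of the random signs: in each pair of words differing only in the lowest
  digit, the cross terms cancel. The product is bilinear, without conjugation, as in the
  trace.\<close>

lemma sum_rademacher_mult:
  fixes x y :: "nat \<Rightarrow> 'a::comm_ring_1"
  shows "(\<Sum>w<2 ^ l. rademacher_sum l x w * rademacher_sum l y w) = 2 ^ l * (\<Sum>i<l. x i * y i)"
proof (induction l)
  case (Suc l)
  let ?F = "rademacher_sum l x" and ?G = "rademacher_sum l y"
  have "(\<Sum>w<2 ^ Suc l. rademacher_sum (Suc l) x w * rademacher_sum (Suc l) y w)
      = (\<Sum>w<2 ^ l. (?F w + x l) * (?G w + y l) + (?F w - x l) * (?G w - y l))"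
    unfolding sum_lessThan_power_Suc by simp
  also have "\<dots> = (\<Sum>w<2 ^ l. 2 * (?F w * ?G w) + 2 * (x l * y l))"
    by (simp add: algebra_simps)
  also have "\<dots> = 2 * (2 ^ l * (\<Sum>i<l. x i * y i)) + 2 ^ l * (2 * (x l * y l))"
    using Suc by (simp add: sum.distrib flip: sum_distrib_left)
  finally show ?case by (simp add: algebra_simps)
qed simp

text \<open>The same orthogonality for norms, by the parallelogram law. It is a separate fact
  because over the complex numbers the squared norm is not \<open>x * x\<close>.\<close>

lemma sum_rademacher_norm_sq:
  fixes x :: "nat \<Rightarrow> 'a::real_inner"
  shows "(\<Sum>w<2 ^ l. (norm (rademacher_sum l x w))\<^sup>2) = 2 ^ l * (\<Sum>i<l. (norm (x i))\<^sup>2)"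
proof (induction l)
  case (Suc l)
  let ?F = "rademacher_sum l x"
  have "(\<Sum>w<2 ^ Suc l. (norm (rademacher_sum (Suc l) x w))\<^sup>2)
      = (\<Sum>w<2 ^ l. 2 * (norm (?F w))\<^sup>2 + 2 * (norm (x l))\<^sup>2)"
    unfolding sum_lessThan_power_Suc by (simp add: parallelogram)
  also have "\<dots> = 2 * (2 ^ l * (\<Sum>i<l. (norm (x i))\<^sup>2)) + 2 ^ l * (2 * (norm (x l))\<^sup>2)"
    using Suc by (simp add: sum.distrib flip: sum_distrib_left)
  finally show ?case by (simp add: algebra_simps)
qed simp

text \<open>Khintchine's inequality for exponent 4. The constant 3 makes the mixed term 12 in
  \<open>fourth_power_parallelogram\<close> fit the square of the enlarged sum, with a surplus
  \<open>4 * ?b^2\<close> that is dropped.\<close>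

lemma sum_rademacher_norm_pow4_le:
  fixes x :: "nat \<Rightarrow> 'a::real_inner"
  shows "(\<Sum>w<2 ^ l. (norm (rademacher_sum l x w)) ^ 4) \<le> 2 ^ l * (3 * (\<Sum>i<l. (norm (x i))\<^sup>2)\<^sup>2)"
proof (induction l)
  case (Suc l)
  let ?F = "rademacher_sum l x" and ?s = "\<Sum>i<l. (norm (x i))\<^sup>2" and ?b = "(norm (x l))\<^sup>2"
  have "(\<Sum>w<2 ^ Suc l. (norm (rademacher_sum (Suc l) x w)) ^ 4)
      \<le> (\<Sum>w<2 ^ l. 2 * (norm (?F w)) ^ 4 + 12 * (norm (?F w))\<^sup>2 * ?b + 2 * (norm (x l)) ^ 4)"
    unfolding sum_lessThan_power_Suc by (intro sum_mono) (simp add: fourth_power_parallelogram)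
  also have "\<dots> = 2 * (\<Sum>w<2 ^ l. (norm (?F w)) ^ 4)
      + 12 * (\<Sum>w<2 ^ l. (norm (?F w))\<^sup>2) * ?b + 2 ^ l * (2 * (norm (x l)) ^ 4)"
    by (simp add: sum.distrib sum_distrib_left sum_distrib_right)
  also have "\<dots> \<le> 2 * (2 ^ l * (3 * ?s\<^sup>2)) + 12 * (2 ^ l * ?s) * ?b + 2 ^ l * (2 * ?b\<^sup>2)"
    using Suc unfolding sum_rademacher_norm_sq by (simp flip: power_mult)
  also have "\<dots> = 2 ^ Suc l * (3 * (?s + ?b)\<^sup>2) - 2 ^ l * (4 * ?b\<^sup>2)"
    by (simp add: power2_eq_square algebra_simps)
  also have "\<dots> \<le> 2 ^ Suc l * (3 * (?s + ?b)\<^sup>2)" by simp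
  finally show ?case by simp
qed simp

section \<open>Radial truncation at height 2\<close>

definition trunc2 :: "'a::real_normed_vector \<Rightarrow> 'a" where
  "trunc2 g = (if norm g \<le> 2 then g else (2 / norm g) *\<^sub>R g)"

lemma norm_trunc2_le: "norm (trunc2 g) \<le> 2" "norm (trunc2 g) \<le> norm g"
  by (auto simp: trunc2_def)

text \<open>From \<open>\<bar>g\<bar> - 2 \<le> \<bar>g\<bar>\<^sup>2 / 8\<close>, that is, \<open>(\<bar>g\<bar> - 4)\<^sup>2 \<ge> 0\<close>.\<close>

lemma norm_diff_trunc2_le: "norm (g - trunc2 g) \<le> (norm g)\<^sup>2 / 8"
proof (cases "norm g \<le> 2")
  case False
  then have "g - trunc2 g = (1 - 2 / norm g) *\<^sub>R g" by (simp add: trunc2_def algebra_simps)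
  also have "norm \<dots> = (1 - 2 / norm g) * norm g"
  proof -
    have "0 \<le> 1 - 2 / norm g" using False by (simp add: divide_le_eq_1)
    then show ?thesis by simp
  qed
  also have "\<dots> = norm g - 2" using False by (auto simp: left_diff_distrib)
  also have "\<dots> \<le> (norm g)\<^sup>2 / 8"
    using zero_le_power2[of "norm g - 4"] by (simp add: power2_eq_square algebra_simps)
  finally show ?thesis .
qed (simp add: trunc2_def)

section \<open>Self-improvement of the vector-valued bilinear form\<close>

locale cut_norm_bound =
  fixes m n :: nat and A :: "nat \<Rightarrow> nat \<Rightarrow> 'a::{real_normed_field, real_inner}" and B :: real
  assumes bound: "\<And>s t. (\<And>j. j < m \<Longrightarrow> norm (s j) \<le> 1) \<Longrightarrow> (\<And>k. k < n \<Longrightarrow> norm (t k) \<le> 1) \<Longrightarrow>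
    norm (\<Sum>j<m. \<Sum>k<n. A j k * (s j * t k)) \<le> B"
begin

text \<open>The length \<open>l\<close> is an argument, not a locale parameter, because the
  improvement step passes from vectors of length \<open>l\<close> to vectors of length
  \<open>2 ^ l\<close>.\<close>

definition form :: "nat \<Rightarrow> (nat \<Rightarrow> nat \<Rightarrow> 'a) \<Rightarrow> (nat \<Rightarrow> nat \<Rightarrow> 'a) \<Rightarrow> 'a" where
  "form l x y = (\<Sum>j<m. \<Sum>k<n. A j k * (\<Sum>i<l. x j i * y k i))"

definition contractive :: "nat \<Rightarrow> nat \<Rightarrow> (nat \<Rightarrow> nat \<Rightarrow> 'a) \<Rightarrow> bool" where
  "contractive d l x \<longleftrightarrow> (\<forall>j<d. (\<Sum>i<l. (norm (x j i))\<^sup>2) \<le> 1)"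

lemma contractive_normalize:
  assumes "0 < a" "\<And>j. j < d \<Longrightarrow> (\<Sum>i<l. (norm (x j i))\<^sup>2) \<le> a\<^sup>2"
  shows "contractive d l (\<lambda>j i. inverse a *\<^sub>R x j i)"
  unfolding contractive_def
proof (intro allI impI)
  fix j assume "j < d"
  have "(\<Sum>i<l. (norm (inverse a *\<^sub>R x j i))\<^sup>2) = (\<Sum>i<l. (norm (x j i))\<^sup>2) / a\<^sup>2"
    using assms(1) by (simp add: sum_distrib_left divide_inverse_commute power_mult_distrib power_inverse)
  also have "\<dots> \<le> 1" using assms(1) assms(2)[OF \<open>j < d\<close>] by simp
  finally show "(\<Sum>i<l. (norm (inverse a *\<^sub>R x j i))\<^sup>2) \<le> 1" .
qed

lemma form_add_left: "form l (\<lambda>j i. x j i + x' j i) y = form l x y + form l x' y"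
  by (simp add: form_def sum.distrib algebra_simps)

lemma form_add_right: "form l x (\<lambda>k i. y k i + y' k i) = form l x y + form l x y'"
  by (simp add: form_def sum.distrib algebra_simps)

lemma form_scaleR: "form l (\<lambda>j i. c *\<^sub>R x j i) (\<lambda>k i. d *\<^sub>R y k i) = (c * d) *\<^sub>R form l x y"
  by (simp add: form_def scaleR_sum_right[symmetric] mult.commute)

text \<open>With the coordinate outermost, each \<open>i\<close> contributes a scalar bilinear form,
  to which \<open>bound\<close> can apply.\<close>

lemma form_eq_sum: "form l x y = (\<Sum>i<l. \<Sum>j<m. \<Sum>k<n. A j k * (x j i * y k i))"
  unfolding form_def sum_distrib_left
  by (subst (2) sum.swap, subst sum.swap) simp

text \<open>For each coordinate, halving both families gives scalars admissible in
  \<open>bound\<close>. Undoing the two halvings costs the factor 4.\<close>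

lemma form_bounded:
  assumes "\<And>j i. j < m \<Longrightarrow> i < l \<Longrightarrow> norm (x j i) \<le> 2" "\<And>k i. k < n \<Longrightarrow> i < l \<Longrightarrow> norm (y k i) \<le> 2"
  shows "norm (form l x y) \<le> real l * (4 * B)"
proof -
  have "norm (\<Sum>j<m. \<Sum>k<n. A j k * (x j i * y k i)) \<le> 4 * B" if "i < l" for i
  proof -
    have "norm (\<Sum>j<m. \<Sum>k<n. A j k * ((x j i /\<^sub>R 2) * (y k i /\<^sub>R 2))) \<le> B"
      using assms that by (intro bound) (auto simp: field_simps)
    also have "(\<Sum>j<m. \<Sum>k<n. A j k * ((x j i /\<^sub>R 2) * (y k i /\<^sub>R 2)))
        = (1 / 4) *\<^sub>R (\<Sum>j<m. \<Sum>k<n. A j k * (x j i * y k i))"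
      by (simp add: scaleR_sum_right)
    finally show ?thesis by simp
  qed
  then show ?thesis
    unfolding form_eq_sum
    by (rule order_trans[OF sum_norm_le[where g = "\<lambda>_. 4 * B"]]) auto
qed

text \<open>The bound depends on \<open>A\<close> but not on \<open>l\<close>. It serves to make the
  supremum over all lengths finite.\<close>

lemma form_trivial_bound:
  assumes "contractive m l x" "contractive n l y"
  shows "norm (form l x y) \<le> (\<Sum>j<m. \<Sum>k<n. norm (A j k))"
  unfolding form_def
proof (intro sum_norm_le)
  fix j k assume jk: "j \<in> {..<m}" "k \<in> {..<n}"
  have "norm (\<Sum>i<l. x j i * y k i) \<le> (\<Sum>i<l. ((norm (x j i))\<^sup>2 + (norm (y k i))\<^sup>2) / 2)"
  proof (intro sum_norm_le)
    fix i
    show "norm (x j i * y k i) \<le> ((norm (x j i))\<^sup>2 + (norm (y k i))\<^sup>2) / 2"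
      using sum_squares_bound[of "norm (x j i)" "norm (y k i)"] by (simp add: norm_mult)
  qed
  also have "\<dots> = ((\<Sum>i<l. (norm (x j i))\<^sup>2) + (\<Sum>i<l. (norm (y k i))\<^sup>2)) / 2"
    by (simp add: sum.distrib flip: sum_divide_distrib)
  also have "\<dots> \<le> 1" using assms jk by (force simp: contractive_def)
  finally show "norm (A j k * (\<Sum>i<l. x j i * y k i)) \<le> norm (A j k)"
    by (simp add: norm_mult mult_left_le)
qed

text \<open>The inner products are those of the Rademacher sums \<open>F\<close>, \<open>G\<close> in \<open>L\<^sup>2\<close> of the cube.
  Truncating \<open>F\<close> and \<open>G\<close> at height 2 makes \<open>bound\<close> applicable at every point of the cube, and
  each of the two errors is again a value of the form, at vectors of norm at most \<open>1/4\<close> and \<open>1\<close>.\<close>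

lemma form_improve:
  assumes \<Gamma>: "\<And>l x y. contractive m l x \<Longrightarrow> contractive n l y \<Longrightarrow> norm (form l x y) \<le> \<Gamma>"
    and x: "contractive m l x" and y: "contractive n l y"
  shows "norm (form l x y) \<le> 4 * B + \<Gamma> / 2"
proof -
  define N where "N = (2::nat) ^ l"
  have N: "0 < real N" "real N = 2 ^ l" unfolding N_def by simp_all
  define F where "F = (\<lambda>j. rademacher_sum l (x j))"
  define G where "G = (\<lambda>k. rademacher_sum l (y k))"
  \<comment> \<open>By \<open>norm_diff_trunc2_le\<close> and the fourth moment bound, a tail has
    mean square at most 3/64, so 4 times a tail has mean square at most 3/4. Dividing by
    \<open>sqrt (real N)\<close> turns mean squares into sums, and \<open>e * f = 4 / N\<close>
    makes each error at most \<open>N * \<Gamma> / 4\<close>.\<close>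
  define e where "e = 4 / sqrt (real N)"
  define f where "f = 1 / sqrt (real N)"
  have ef: "e\<^sup>2 = 16 / real N" "f\<^sup>2 = 1 / real N" "e * f = 4 / real N" "f * e = 4 / real N"
    using N by (simp_all add: e_def f_def power_divide)
  \<comment> \<open>A general dominated \<open>h\<close> covers both the full Rademacher sum and its
    truncation.\<close>
  have whole: "contractive d N (\<lambda>j w. f *\<^sub>R h j w)"
    if z: "contractive d l z" and h: "\<And>j w. norm (h j w) \<le> norm (rademacher_sum l (z j) w)" for d z h
    unfolding contractive_def
  proof (intro allI impI)
    fix j assume j: "j < d"
    have "(\<Sum>w<N. (norm (f *\<^sub>R h j w))\<^sup>2) = f\<^sup>2 * (\<Sum>w<N. (norm (h j w))\<^sup>2)"
      by (simp add: power_mult_distrib sum_distrib_left)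
    also have "\<dots> \<le> f\<^sup>2 * (\<Sum>w<N. (norm (rademacher_sum l (z j) w))\<^sup>2)"
      using h by (intro mult_left_mono sum_mono power_mono) auto
    also have "\<dots> = (\<Sum>i<l. (norm (z j i))\<^sup>2)"
      unfolding N_def sum_rademacher_norm_sq using N by (simp add: ef)
    finally show "(\<Sum>w<N. (norm (f *\<^sub>R h j w))\<^sup>2) \<le> 1" using z j unfolding contractive_def by fastforce
  qed
  have tail: "contractive d N
      (\<lambda>j w. e *\<^sub>R (rademacher_sum l (z j) w - trunc2 (rademacher_sum l (z j) w)))"
    if z: "contractive d l z" for d z
    unfolding contractive_def
  proof (intro allI impI)
    fix j assume j: "j < d"
    let ?h = "rademacher_sum l (z j)"
    have "(\<Sum>w<N. (norm (e *\<^sub>R (?h w - trunc2 (?h w))))\<^sup>2)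
        = e\<^sup>2 * (\<Sum>w<N. (norm (?h w - trunc2 (?h w)))\<^sup>2)"
      by (simp add: power_mult_distrib sum_distrib_left)
    also have "\<dots> \<le> e\<^sup>2 * (\<Sum>w<N. ((norm (?h w))\<^sup>2 / 8)\<^sup>2)"
      by (intro mult_left_mono sum_mono power_mono norm_diff_trunc2_le) auto
    also have "\<dots> = e\<^sup>2 / 64 * (\<Sum>w<N. (norm (?h w)) ^ 4)"
      by (simp add: power_divide sum_distrib_left flip: power_mult)
    also have "\<dots> \<le> e\<^sup>2 / 64 * (real N * (3 * (\<Sum>i<l. (norm (z j i))\<^sup>2)\<^sup>2))"
      unfolding N(2) using sum_rademacher_norm_pow4_le[of l "z j"]
      by (intro mult_left_mono) (auto simp: N_def)
    also have "\<dots> \<le> e\<^sup>2 / 64 * (real N * (3 * 1\<^sup>2))"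
      using z j unfolding contractive_def
      by (intro mult_left_mono power_mono) (auto intro: sum_nonneg)
    also have "\<dots> \<le> 1" using N by (simp add: ef)
    finally show "(\<Sum>w<N. (norm (e *\<^sub>R (?h w - trunc2 (?h w))))\<^sup>2) \<le> 1" .
  qed
  let ?tF = "\<lambda>j w. trunc2 (F j w)" and ?tG = "\<lambda>k w. trunc2 (G k w)"
  let ?dF = "\<lambda>j w. F j w - trunc2 (F j w)" and ?dG = "\<lambda>k w. G k w - trunc2 (G k w)"
  have "form N F G = of_nat N * form l x y"
    unfolding form_def F_def G_def N_def by (simp add: sum_rademacher_mult sum_distrib_left ac_simps)
  then have "real N * norm (form l x y) = norm (form N F G)" by (simp add: norm_mult)
  \<comment> \<open>The factors are truncated one after the other, so each error term pairs one tail
    with a family covered by \<open>whole\<close>.\<close>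
  also have "form N F G = form N ?dF G + (form N ?tF ?dG + form N ?tF ?tG)"
    using form_add_right[of N ?tF ?dG ?tG] form_add_left[of N ?dF ?tF G] by simp
  also have "norm \<dots> \<le> norm (form N ?dF G) + (norm (form N ?tF ?dG) + norm (form N ?tF ?tG))"
    by (meson add_left_mono norm_triangle_ineq order_trans)
  also have "norm (form N ?tF ?tG) \<le> real N * (4 * B)"
    by (intro form_bounded norm_trunc2_le)
  also have "norm (form N ?dF G) \<le> real N * (\<Gamma> / 4)"
  proof -
    have "norm (form N (\<lambda>j w. e *\<^sub>R ?dF j w) (\<lambda>k w. f *\<^sub>R G k w)) \<le> \<Gamma>"
      unfolding F_def G_def by (intro \<Gamma> tail[OF x] whole[OF y]) auto
    then show ?thesis using N unfolding form_scaleR ef by (simp add: field_simps)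
  qed
  also have "norm (form N ?tF ?dG) \<le> real N * (\<Gamma> / 4)"
  proof -
    have "norm (form N (\<lambda>j w. f *\<^sub>R ?tF j w) (\<lambda>k w. e *\<^sub>R ?dG k w)) \<le> \<Gamma>"
      unfolding F_def G_def by (intro \<Gamma> tail[OF y] whole[OF x] norm_trunc2_le)
    then show ?thesis using N unfolding form_scaleR ef by (simp add: field_simps)
  qed
  finally have "real N * norm (form l x y) \<le> real N * (4 * B + \<Gamma> / 2)"
    by (simp add: algebra_simps)
  then show ?thesis using N by simp
qed

text \<open>The supremum is taken over all lengths at once, so \<open>form_improve\<close> bounds it
  in terms of itself. Being finite, it can absorb its own half.\<close>

theorem grothendieck_inequality:
  assumes "contractive m l x" "contractive n l y"
  shows "norm (form l x y) \<le> 8 * B"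
proof -
  define V where "V = {norm (form l x y) | l x y. contractive m l x \<and> contractive n l y}"
  have bdd: "bdd_above V"
    unfolding V_def by (rule bdd_aboveI) (use form_trivial_bound in blast)
  have upper: "norm (form l x y) \<le> Sup V" if "contractive m l x" "contractive n l y" for l x y
    using that by (intro cSup_upper bdd) (auto simp: V_def)
  have "Sup V \<le> 4 * B + Sup V / 2"
  proof (rule cSup_least)
    show "V \<noteq> {}" using assms by (auto simp: V_def)
  qed (use form_improve[OF upper] in \<open>auto simp: V_def\<close>)
  then show ?thesis using upper[OF assms] by simp
qed

end

subsection \<open>Norms of identity and Hadamard matrices\<close>

text \<open>The value at \<infinity> is 0, since \<open>real_of_ereal\<close> sends \<infinity> to 0
  and division by 0 gives 0. All powers of the dimension below are linear or piecewise linear in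
  these reciprocals.\<close>

definition recip :: "ereal \<Rightarrow> real" where
  "recip s = 1 / real_of_ereal s"

lemma recip_simps [simp]: "recip 1 = 1" "recip 2 = 1 / 2" "recip \<infinity> = 0" "recip (ereal u) = 1 / u"
  using real_of_ereal.simps(1)[of 2] by (simp_all add: recip_def)

lemma recip_bounds:
  assumes "1 \<le> s" shows "0 \<le> recip s" "recip s \<le> 1"
  using assms by (cases s; simp)+

lemma recip_eq_iff:
  assumes "1 \<le> s" "1 \<le> t"
  shows "recip s = recip t \<longleftrightarrow> s = t"
  using assms by (cases s; cases t; simp)

section \<open>Comparison of l^p norms in a fixed dimension\<close>

lemma lp_norm_infinity: "lp_norm \<infinity> x = Max ((\<lambda>i. norm (x $ i)) ` {..<dim_vec x})"
  by (simp add: lp_norm_def)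

lemma lp_norm_ereal: "lp_norm (ereal u) x = (\<Sum>i<dim_vec x. norm (x $ i) powr u) powr (1 / u)"
  by (simp add: lp_norm_def)

lemma lp_norm_1: "lp_norm 1 x = (\<Sum>i<dim_vec x. norm (x $ i))"
  using lp_norm_ereal[of 1 x] by (simp add: one_ereal_def sum_nonneg)

lemma lp_norm_2: "lp_norm (ereal 2) x = sqrt (\<Sum>i<dim_vec x. (norm (x $ i))\<^sup>2)"
  by (simp add: lp_norm_ereal powr_half_sqrt sum_nonneg)

lemma lp_norm_powr:
  assumes "1 \<le> u"
  shows "lp_norm (ereal u) x powr u = (\<Sum>i<dim_vec x. norm (x $ i) powr u)"
  using assms by (simp add: lp_norm_ereal powr_powr sum_nonneg)

lemma lp_norm_nonneg:
  assumes "1 \<le> s" "0 < dim_vec x"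
  shows "0 \<le> lp_norm s x"
  using norm_le_lp_norm[OF assms] norm_ge_zero order_trans by blast

text \<open>Every entry is at most \<open>a\<close>, the norm with the smaller exponent, so
  \<open>v - u\<close> of the \<open>v\<close> factors in each power can be replaced by powers of
  \<open>a\<close>.\<close>

lemma lp_norm_antimono:
  assumes "1 \<le> s" "s \<le> t" "0 < dim_vec x"
  shows "lp_norm t x \<le> lp_norm s x"
proof (cases "t = \<infinity>")
  case True
  then show ?thesis using assms norm_le_lp_norm[OF assms(1)]
    by (auto simp: lp_norm_infinity intro!: Max.boundedI)
next
  case False
  then obtain u v where u: "s = ereal u" "1 \<le> u" and v: "t = ereal v" "u \<le> v"
    using assms by (cases s; cases t) auto
  define a where "a = lp_norm s x"
  have a0: "0 \<le> a" unfolding a_def by (intro lp_norm_nonneg assms)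
  have "(\<Sum>i<dim_vec x. norm (x $ i) powr v) = (\<Sum>i<dim_vec x. norm (x $ i) powr u * norm (x $ i) powr (v - u))"
    by (simp flip: powr_add)
  also have "\<dots> \<le> (\<Sum>i<dim_vec x. norm (x $ i) powr u * a powr (v - u))"
    using u v assms unfolding a_def
    by (intro sum_mono mult_left_mono powr_mono2 norm_le_lp_norm) auto
  also have "\<dots> = a powr u * a powr (v - u)"
    using lp_norm_powr[OF u(2), of x] by (simp add: a_def u sum_distrib_right)
  also have "\<dots> = a powr v" by (simp flip: powr_add)
  finally have "lp_norm t x \<le> (a powr v) powr (1 / v)"
    using u v by (simp add: lp_norm_ereal powr_mono2 sum_nonneg)
  then show ?thesis using u v a0 by (simp add: powr_powr a_def)
qed

text \<open>This is the power mean inequality. For finite exponents it follows from Young's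
  inequality applied to each entry; for \<open>s = \<infinity>\<close> each entry is bounded by the
  maximum.\<close>

lemma lp_norm_le_dim_powr:
  assumes "1 \<le> t" "t \<le> s" "0 < dim_vec x"
  shows "lp_norm t x \<le> real (dim_vec x) powr (recip t - recip s) * lp_norm s x"
proof -
  have s1: "1 \<le> s" using assms by (meson order_trans)
  define N where "N = real (dim_vec x)"
  define a where "a = lp_norm s x"
  have N: "0 < N" using assms by (simp add: N_def)
  have a0: "0 \<le> a" unfolding a_def by (intro lp_norm_nonneg s1 assms)
  show ?thesis
  proof (cases "t = \<infinity>")
    case True
    then have "s = \<infinity>" using assms by simp
    then show ?thesis using True N by (simp flip: N_def)
  next
    case False
    then obtain v where v: "t = ereal v" "1 \<le> v" using assms by (cases t) auto
    have main: "(\<Sum>i<dim_vec x. norm (x $ i) powr v) \<le> N powr (1 - v * recip s) * a powr v"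
    proof (cases "s = \<infinity>")
      case True
      have "(\<Sum>i<dim_vec x. norm (x $ i) powr v) \<le> (\<Sum>i<dim_vec x. a powr v)"
        using v assms s1 unfolding a_def by (intro sum_mono powr_mono2 norm_le_lp_norm) auto
      then show ?thesis using True N by (simp add: N_def)
    next
      case False
      then obtain u where u: "s = ereal u" "v \<le> u" using assms v by (cases s) auto
      \<comment> \<open>The mean of the \<open>u\<close>-th powers. Young's inequality with weights
        \<open>v / u\<close> and \<open>1 - v / u\<close> pairs each \<open>u\<close>-th power with
        it, so that the right-hand sides add up to exactly \<open>N * \<mu>\<close>.\<close>
      define \<mu> where "\<mu> = a powr u / N"
      have S: "(\<Sum>i<dim_vec x. norm (x $ i) powr u) = a powr u"
        using lp_norm_powr[of u x] u v by (simp add: a_def)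
      show ?thesis
      \<comment> \<open>For \<open>a = 0\<close> the mean \<mu> is 0 and its power could not be
        cancelled.\<close>
      proof (cases "a = 0")
        case True
        then have "norm (x $ i) = 0" if "i < dim_vec x" for i
          using norm_le_lp_norm[OF s1 that] unfolding a_def by simp
        then show ?thesis using True by simp
      next
        case False
        then have a: "0 < a" using a0 by simp
        have \<mu>: "0 < \<mu>" using a N by (simp add: \<mu>_def)
        have "norm (x $ i) powr v * \<mu> powr (1 - v / u) \<le> v / u * norm (x $ i) powr u + (1 - v / u) * \<mu>" for i
        proof (cases "x $ i = 0")
          case False
          then show ?thesis
            using Youngs_inequality_0[of "v / u" "1 - v / u" "norm (x $ i) powr u" \<mu>] \<mu> u v
            by (simp add: powr_powr)
        qed (use \<mu> u v in simp)
        then have "(\<Sum>i<dim_vec x. norm (x $ i) powr v * \<mu> powr (1 - v / u))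
            \<le> (\<Sum>i<dim_vec x. v / u * norm (x $ i) powr u + (1 - v / u) * \<mu>)"
          by (intro sum_mono)
        also have "\<dots> = v / u * a powr u + N * ((1 - v / u) * \<mu>)"
          by (simp add: sum.distrib S N_def flip: sum_distrib_left sum_divide_distrib)
        also have "\<dots> = N * \<mu>" using N u v by (simp add: \<mu>_def field_simps)
        finally have "(\<Sum>i<dim_vec x. norm (x $ i) powr v) * \<mu> powr (1 - v / u) \<le> N * \<mu>"
          by (simp add: sum_distrib_right)
        also have "N * \<mu> = N * \<mu> powr (v / u) * \<mu> powr (1 - v / u)"
          using \<mu> by (simp add: mult.assoc flip: powr_add)
        finally have "(\<Sum>i<dim_vec x. norm (x $ i) powr v) \<le> N * \<mu> powr (v / u)"
          using \<mu> by simp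
        also have "\<dots> = N powr (1 - v * recip s) * a powr v"
          using N a u v by (simp add: \<mu>_def powr_divide powr_powr powr_diff)
        finally show ?thesis .
      qed
    qed
    then have "lp_norm t x \<le> (N powr (1 - v * recip s) * a powr v) powr (1 / v)"
      using v by (simp add: lp_norm_ereal powr_mono2 sum_nonneg)
    also have "\<dots> = N powr (recip t - recip s) * a"
      using v a0 by (simp add: powr_mult powr_powr field_simps)
    finally show ?thesis by (simp add: N_def a_def)
  qed
qed

lemma lp_norm_compare:
  assumes "1 \<le> s" "1 \<le> t" "0 < dim_vec x"
  shows "lp_norm t x \<le> real (dim_vec x) powr max 0 (recip t - recip s) * lp_norm s x"
proof (cases "s \<le> t")
  case True
  have "lp_norm t x \<le> 1 * lp_norm s x" using lp_norm_antimono[OF assms(1) True assms(3)] by simp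
  also have "\<dots> \<le> real (dim_vec x) powr max 0 (recip t - recip s) * lp_norm s x"
    using assms by (intro mult_right_mono lp_norm_nonneg ge_one_powr_ge_zero) auto
  finally show ?thesis .
next
  case False
  then have "lp_norm t x \<le> real (dim_vec x) powr (recip t - recip s) * lp_norm s x"
    using assms by (intro lp_norm_le_dim_powr) auto
  also have "\<dots> \<le> real (dim_vec x) powr max 0 (recip t - recip s) * lp_norm s x"
    using assms by (intro mult_right_mono lp_norm_nonneg powr_mono) auto
  finally show ?thesis .
qed

section \<open>Operator norms by testing vectors\<close>

lemma op_norm_le:
  fixes A :: "'a::real_normed_field mat"
  assumes "1 \<le> s" "A \<in> carrier_mat a b" "0 < b"
    and le: "\<And>x. x \<in> carrier_vec b \<Longrightarrow> lp_norm t (A *\<^sub>v x) \<le> K * lp_norm s x"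
  shows "op_norm s t A \<le> K"
  unfolding op_norm_def
proof (rule cSup_least)
  have "unit_vec b 0 \<noteq> (0\<^sub>v b :: 'a vec)" "unit_vec b 0 \<in> (carrier_vec b :: 'a vec set)"
    using assms(3) by (metis index_unit_vec(1) index_zero_vec(1) zero_neq_one, simp)
  then show "{lp_norm t (A *\<^sub>v x) / lp_norm s x |x. x \<in> carrier_vec (dim_col A) \<and> x \<noteq> 0\<^sub>v (dim_col A)} \<noteq> {}"
    using assms(2) by fastforce
next
  fix z assume "z \<in> {lp_norm t (A *\<^sub>v x) / lp_norm s x |x. x \<in> carrier_vec (dim_col A) \<and> x \<noteq> 0\<^sub>v (dim_col A)}"
  then obtain x where x: "x \<in> carrier_vec b" "x \<noteq> 0\<^sub>v b" and z: "z = lp_norm t (A *\<^sub>v x) / lp_norm s x"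
    using assms(2) by auto
  show "z \<le> K" using le[OF x(1)] lp_norm_pos[OF assms(1) x] by (simp add: z pos_divide_le_eq)
qed

lemma lp_norm_mult_mat_vec_le:
  fixes A :: "'a::real_normed_field mat"
  assumes "1 \<le> s" "1 \<le> t" "A \<in> carrier_mat a b" "0 < a" "x \<in> carrier_vec b" "x \<noteq> 0\<^sub>v b"
  shows "lp_norm t (A *\<^sub>v x) \<le> op_norm s t A * lp_norm s x"
proof -
  have "lp_norm t (A *\<^sub>v x) / lp_norm s x \<le> op_norm s t A"
    unfolding op_norm_def using assms bdd_above_op_norm[of s t A]
    by (intro cSup_upper) auto
  then show ?thesis using lp_norm_pos[OF assms(1,5,6)] by (simp add: pos_divide_le_eq)
qed

lemma op_norm_one_mat_le:
  assumes "1 \<le> s" "1 \<le> t" "0 < N"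
  shows "op_norm s t (1\<^sub>m N :: 'a::real_normed_field mat) \<le> real N powr max 0 (recip t - recip s)"
  proof (rule op_norm_le[OF assms(1) one_carrier_mat assms(3)])
  fix x :: "'a vec" assume "x \<in> carrier_vec N"
  then show "lp_norm t (1\<^sub>m N *\<^sub>v x) \<le> real N powr max 0 (recip t - recip s) * lp_norm s x"
    using lp_norm_compare[of s t x] assms by simp
qed

text \<open>Sylvester's construction: the sign is -1 to the number of positions, among the last
  \<open>k\<close> binary digits, where both indices have a 1.\<close>

fun hadamard :: "nat \<Rightarrow> nat \<Rightarrow> nat \<Rightarrow> 'a::comm_ring_1" where
  "hadamard 0 i j = 1"
| "hadamard (Suc k) i j = (if odd i \<and> odd j then - 1 else 1) * hadamard k (i div 2) (j div 2)"

lemma hadamard_sym: "hadamard k i j = hadamard k j i"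
  by (induction k arbitrary: i j) auto

lemma hadamard_square [simp]: "hadamard k i j * hadamard k i j = 1"
  by (induction k arbitrary: i j) auto

lemma norm_hadamard [simp]: "norm (hadamard k i j :: 'a::real_normed_field) = 1"
  by (induction k arbitrary: i j) (auto simp: norm_mult)

text \<open>One step of the fast Walsh transform: rows \<open>2 * i\<close> and
  \<open>2 * i + 1\<close> give the sum and the difference of the transforms of the even and odd
  parts, and the parallelogram law doubles the energy.\<close>

lemma hadamard_isometry:
  fixes x :: "nat \<Rightarrow> 'a::{real_normed_field, real_inner}"
  shows "(\<Sum>i<2 ^ k. (norm (\<Sum>j<2 ^ k. hadamard k i j * x j))\<^sup>2) = 2 ^ k * (\<Sum>j<2 ^ k. (norm (x j))\<^sup>2)"
proof (induction k arbitrary: x)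
  case (Suc k)
  let ?e = "\<lambda>i. \<Sum>j<2 ^ k. hadamard k i j * x (2 * j)"
  let ?o = "\<lambda>i. \<Sum>j<2 ^ k. hadamard k i j * x (2 * j + 1)"
  have "(\<Sum>i<2 ^ Suc k. (norm (\<Sum>j<2 ^ Suc k. hadamard (Suc k) i j * x j))\<^sup>2)
      = (\<Sum>i<2 ^ k. (norm (?e i + ?o i))\<^sup>2 + (norm (?e i - ?o i))\<^sup>2)"
    unfolding sum_lessThan_power_Suc by (simp add: sum.distrib sum_subtractf)
  also have "\<dots> = 2 * (\<Sum>i<2 ^ k. (norm (?e i))\<^sup>2) + 2 * (\<Sum>i<2 ^ k. (norm (?o i))\<^sup>2)"
    by (simp add: parallelogram sum.distrib sum_distrib_left)
  also have "\<dots> = 2 ^ Suc k * (\<Sum>j<2 ^ Suc k. (norm (x j))\<^sup>2)"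
    unfolding Suc sum_lessThan_power_Suc by (simp add: sum.distrib algebra_simps)
  finally show ?case .
qed simp

definition hadamard_mat :: "nat \<Rightarrow> 'a::comm_ring_1 mat" where
  "hadamard_mat k = mat (2 ^ k) (2 ^ k) (\<lambda>(i, j). hadamard k i j)"

lemma hadamard_mat_carrier [simp]: "hadamard_mat k \<in> carrier_mat (2 ^ k) (2 ^ k)"
  by (simp add: hadamard_mat_def)

lemma dim_hadamard_mat [simp]:
  "dim_row (hadamard_mat k) = 2 ^ k" "dim_col (hadamard_mat k) = 2 ^ k"
  by (simp_all add: hadamard_mat_def)

lemma hadamard_mat_mult_vec:
  assumes "x \<in> carrier_vec (2 ^ k)" "i < 2 ^ k"
  shows "(hadamard_mat k *\<^sub>v x) $ i = (\<Sum>j<2 ^ k. hadamard k i j * x $ j)"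
  using assms by (simp add: hadamard_mat_def scalar_prod_def atLeast0LessThan)

text \<open>Factor through the Euclidean norm on both sides; the middle map contributes the exponent
  1/2 by \<open>hadamard_isometry\<close>.\<close>

lemma op_norm_hadamard_le_euclidean:
  assumes "1 \<le> s" "1 \<le> t"
  shows "op_norm s t (hadamard_mat k :: 'a::{real_normed_field, real_inner} mat)
    \<le> (2 ^ k) powr (max 0 (recip t - 1 / 2) + 1 / 2 + max 0 (1 / 2 - recip s))"
proof (rule op_norm_le[OF assms(1) hadamard_mat_carrier])
  fix x :: "'a vec" assume x: "x \<in> carrier_vec (2 ^ k)"
  let ?N = "2 ^ k :: real" and ?H = "hadamard_mat k :: 'a mat"
  have "lp_norm 2 (?H *\<^sub>v x) = sqrt (?N * (\<Sum>j<2 ^ k. (norm (x $ j))\<^sup>2))"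
    using hadamard_isometry[of k "\<lambda>j. x $ j"] x by (simp add: lp_norm_2 hadamard_mat_mult_vec del: index_mult_mat_vec)
  also have "\<dots> = ?N powr (1 / 2) * lp_norm 2 x"
    using x by (simp add: lp_norm_2 real_sqrt_mult powr_half_sqrt)
  finally have 2: "lp_norm 2 (?H *\<^sub>v x) = ?N powr (1 / 2) * lp_norm 2 x" .
  have "lp_norm t (?H *\<^sub>v x) \<le> ?N powr max 0 (recip t - 1 / 2) * lp_norm 2 (?H *\<^sub>v x)"
    using lp_norm_compare[of 2 t "?H *\<^sub>v x"] assms by simp
  also have "\<dots> \<le> ?N powr max 0 (recip t - 1 / 2)
      * (?N powr (1 / 2) * (?N powr max 0 (1 / 2 - recip s) * lp_norm s x))"
    unfolding 2 using lp_norm_compare[of s 2 x] assms x by (intro mult_left_mono) auto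
  finally show "lp_norm t (?H *\<^sub>v x)
      \<le> ?N powr (max 0 (recip t - 1 / 2) + 1 / 2 + max 0 (1 / 2 - recip s)) * lp_norm s x"
    by (simp add: powr_add mult.assoc)
qed simp

text \<open>Factor through l^1 and l^\<infinity> instead: between these the norm is at most 1, since
  all entries have modulus 1.\<close>

lemma op_norm_hadamard_le_entry:
  assumes "1 \<le> s" "1 \<le> t"
  shows "op_norm s t (hadamard_mat k :: 'a::real_normed_field mat)
    \<le> (2 ^ k) powr (recip t + (1 - recip s))"
proof (rule op_norm_le[OF assms(1) hadamard_mat_carrier])
  fix x :: "'a vec" assume x: "x \<in> carrier_vec (2 ^ k)"
  let ?N = "2 ^ k :: real" and ?H = "hadamard_mat k :: 'a mat"
  have "norm ((?H *\<^sub>v x) $ i) \<le> (\<Sum>j<2 ^ k. norm (x $ j))" if "i < 2 ^ k" for i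
    unfolding hadamard_mat_mult_vec[OF x that] by (intro sum_norm_le) (simp add: norm_mult)
  then have "lp_norm \<infinity> (?H *\<^sub>v x) \<le> lp_norm 1 x"
    using x by (auto simp: lp_norm_infinity lp_norm_1 lessThan_empty_iff simp del: index_mult_mat_vec intro!: Max.boundedI)
  also have "\<dots> \<le> ?N powr (1 - recip s) * lp_norm s x"
    using lp_norm_compare[of s 1 x] assms x recip_bounds[OF assms(1)] by (simp add: max_def)
  finally have inf: "lp_norm \<infinity> (?H *\<^sub>v x) \<le> ?N powr (1 - recip s) * lp_norm s x" .
  have "lp_norm t (?H *\<^sub>v x) \<le> ?N powr recip t * lp_norm \<infinity> (?H *\<^sub>v x)"
    using lp_norm_compare[of \<infinity> t "?H *\<^sub>v x"] assms recip_bounds[OF assms(2)] by (simp add: max_def)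
  also have "\<dots> \<le> ?N powr recip t * (?N powr (1 - recip s) * lp_norm s x)"
    using inf by (intro mult_left_mono) auto
  finally show "lp_norm t (?H *\<^sub>v x) \<le> ?N powr (recip t + (1 - recip s)) * lp_norm s x"
    by (simp add: powr_add mult.assoc)
qed simp

lemma trace_hadamard_square: "mat_trace (hadamard_mat k * hadamard_mat k :: 'a::comm_ring_1 mat) = 2 ^ (2 * k)"
proof -
  have "mat_trace (hadamard_mat k * hadamard_mat k :: 'a mat)
      = (\<Sum>i<2 ^ k. \<Sum>j<2 ^ k. hadamard k i j * hadamard k j i)"
    by (simp add: mat_trace_def hadamard_mat_def scalar_prod_def atLeast0LessThan)
  also have "\<dots> = (\<Sum>i<(2::nat) ^ k. \<Sum>j<(2::nat) ^ k. 1 :: 'a)"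
    by (subst hadamard_sym[of k j i for i j]) simp
  also have "\<dots> = 2 ^ (2 * k)" by (simp add: power_add mult_2)
  finally show ?thesis .
qed

subsection \<open>Uniform boundedness of the trace form\<close>

lemma mat_trace_triple:
  fixes X :: "'a::comm_ring_1 mat"
  assumes "X \<in> carrier_mat l m" "M \<in> carrier_mat m n" "Y \<in> carrier_mat n l"
  shows "mat_trace (X * M * Y) = (\<Sum>i<l. \<Sum>j<m. \<Sum>k<n. X $$ (i, j) * M $$ (j, k) * Y $$ (k, i))"
proof -
  have "mat_trace (X * M * Y) = (\<Sum>i<l. \<Sum>k<n. (\<Sum>j<m. X $$ (i, j) * M $$ (j, k)) * Y $$ (k, i))"
    unfolding mat_trace_def using assms
    by (auto simp: times_mat_def[of "X * M"] scalar_prod_def atLeast0LessThan intro!: sum.cong)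
  also have "\<dots> = (\<Sum>i<l. \<Sum>j<m. \<Sum>k<n. X $$ (i, j) * M $$ (j, k) * Y $$ (k, i))"
    unfolding sum_distrib_right by (intro sum.cong refl sum.swap)
  finally show ?thesis .
qed

lemma mat_trace_cyclic:
  fixes X :: "'a::comm_ring_1 mat"
  assumes "X \<in> carrier_mat l m" "M \<in> carrier_mat m n" "Y \<in> carrier_mat n l"
  shows "mat_trace (X * M * Y) = mat_trace (Y * X * M)"
proof -
  have "mat_trace (Y * X * M) = (\<Sum>i<l. \<Sum>k<n. \<Sum>j<m. Y $$ (k, i) * X $$ (i, j) * M $$ (j, k))"
    unfolding mat_trace_triple[OF assms(3,1,2)] by (rule sum.swap)
  also have "\<dots> = (\<Sum>i<l. \<Sum>j<m. \<Sum>k<n. Y $$ (k, i) * X $$ (i, j) * M $$ (j, k))"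
    by (subst (2) sum.swap) simp
  finally show ?thesis unfolding mat_trace_triple[OF assms] by (simp add: ac_simps)
qed

lemma mu_norm_leI:
  assumes "0 < l" "0 < m" "0 < n" "1 \<le> p" "1 \<le> q" "1 \<le> r"
    and le: "\<And>X Y M :: 'a mat.
      X \<in> carrier_mat l m \<Longrightarrow> X \<noteq> 0\<^sub>m l m \<Longrightarrow> Y \<in> carrier_mat n l \<Longrightarrow> Y \<noteq> 0\<^sub>m n l \<Longrightarrow>
      M \<in> carrier_mat m n \<Longrightarrow> M \<noteq> 0\<^sub>m m n \<Longrightarrow>
      norm (mat_trace (X * M * Y)) \<le> C * (op_norm p q X * op_norm q r Y * op_norm r p M)"
  shows "mu_norm TYPE('a::real_normed_field) p q r l m n \<le> C"
  unfolding mu_norm_def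
proof (rule cSup_least, goal_cases)
  case 1
  \<comment> \<open>All-ones matrices witness that the supremum ranges over a nonempty set.\<close>
  have "mat a b (\<lambda>_. 1) \<noteq> (0\<^sub>m a b :: 'a mat)" if "0 < a" "0 < b" for a b
    using that by (metis index_mat(1) index_zero_mat(1) zero_neq_one)
  moreover have "mat a b (\<lambda>_. 1) \<in> (carrier_mat a b :: 'a mat set)" for a b by simp
  ultimately show ?case using assms(1-3) by blast
next
  case (2 z)
  then obtain X Y M :: "'a mat" where X: "X \<in> carrier_mat l m" "X \<noteq> 0\<^sub>m l m"
    and Y: "Y \<in> carrier_mat n l" "Y \<noteq> 0\<^sub>m n l" and M: "M \<in> carrier_mat m n" "M \<noteq> 0\<^sub>m m n"
    and z: "z = norm (mat_trace (X * M * Y)) / (op_norm p q X * op_norm q r Y * op_norm r p M)"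
    by blast
  have "0 < op_norm p q X * op_norm q r Y * op_norm r p M"
    using op_norm_pos assms(4-6) X Y M by (metis mult_pos_pos)
  then show ?case using le[OF X Y M] z by (simp add: pos_divide_le_eq)
qed

lemma norm_mat_trace_le_mu_norm:
  fixes X Y M :: "'a::real_normed_field mat"
  assumes "1 \<le> p" "1 \<le> q" "1 \<le> r"
    and X: "X \<in> carrier_mat l m" "X \<noteq> 0\<^sub>m l m" and Y: "Y \<in> carrier_mat n l" "Y \<noteq> 0\<^sub>m n l"
    and M: "M \<in> carrier_mat m n" "M \<noteq> 0\<^sub>m m n"
  shows "norm (mat_trace (X * M * Y))
    \<le> mu_norm TYPE('a) p q r l m n * (op_norm p q X * op_norm q r Y * op_norm r p M)"
proof -
  have "norm (mat_trace (X * M * Y)) / (op_norm p q X * op_norm q r Y * op_norm r p M)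
      \<le> mu_norm TYPE('a) p q r l m n"
    unfolding mu_norm_def using X Y M bdd_above_mu_norm[OF assms(1-3)]
    by (intro cSup_upper) blast+
  moreover have "0 < op_norm p q X * op_norm q r Y * op_norm r p M"
    using op_norm_pos assms(1-3) X Y M by (metis mult_pos_pos)
  ultimately show ?thesis by (simp add: pos_divide_le_eq)
qed

section \<open>Uniform boundedness as a property of the exponents\<close>

definition mu_bounded :: "'a::real_normed_field itself \<Rightarrow> ereal \<Rightarrow> ereal \<Rightarrow> ereal \<Rightarrow> bool" where
  "mu_bounded T p q r \<longleftrightarrow> (\<exists>C. \<forall>l\<ge>1. \<forall>m\<ge>1. \<forall>n\<ge>1. mu_norm T p q r l m n \<le> C)"

lemma SUP_less_infinity_iff:
  fixes f :: "nat \<Rightarrow> nat \<Rightarrow> nat \<Rightarrow> real"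
  shows "(SUP (l, m, n) \<in> {1..} \<times> {1..} \<times> {1..}. ereal (f l m n)) < \<infinity>
    \<longleftrightarrow> (\<exists>C. \<forall>l\<ge>1. \<forall>m\<ge>1. \<forall>n\<ge>1. f l m n \<le> C)" (is "?S < \<infinity> \<longleftrightarrow> ?R")
proof
  assume S: "?S < \<infinity>"
  have le: "ereal (f l m n) \<le> ?S" if "1 \<le> l" "1 \<le> m" "1 \<le> n" for l m n
    using that by (intro SUP_upper2[of "(l, m, n)"]) auto
  \<comment> \<open>The value at dimensions (1, 1, 1) excludes a supremum of minus infinity.\<close>
  obtain c where c: "?S = ereal c"
    using S le[of 1 1 1] by (cases ?S) auto
  then show ?R using le by (metis ereal_less_eq(3))
next
  assume ?R
  then obtain C where "\<forall>l\<ge>1. \<forall>m\<ge>1. \<forall>n\<ge>1. f l m n \<le> C" by blast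
  then have "?S \<le> ereal C" by (intro SUP_least) auto
  then show "?S < \<infinity>" by (rule order.strict_trans1) simp
qed

lemma SUP_mu_norm_less_infinity_iff:
  "(SUP (l, m, n) \<in> {1..} \<times> {1..} \<times> {1..}. ereal (mu_norm T p q r l m n)) < \<infinity> \<longleftrightarrow> mu_bounded T p q r"
  unfolding mu_bounded_def by (rule SUP_less_infinity_iff)

text \<open>Cyclicity of the trace carries the problem for \<open>(p, q, r)\<close> in dimensions
  \<open>(l, m, n)\<close> to the one for \<open>(q, r, p)\<close> in dimensions
  \<open>(n, l, m)\<close>, with the same constant.\<close>

lemma mu_bounded_cyclic:
  assumes "1 \<le> p" "1 \<le> q" "1 \<le> r" "mu_bounded TYPE('a::real_normed_field) p q r"
  shows "mu_bounded TYPE('a) q r p"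
proof -
  obtain C where C: "\<And>l m n. 1 \<le> l \<Longrightarrow> 1 \<le> m \<Longrightarrow> 1 \<le> n \<Longrightarrow> mu_norm TYPE('a) p q r l m n \<le> C"
    using assms(4) unfolding mu_bounded_def by blast
  have "mu_norm TYPE('a) q r p n l m \<le> C" if "1 \<le> l" "1 \<le> m" "1 \<le> n" for l m n
  proof (rule mu_norm_leI)
    fix X Y M :: "'a mat"
    assume X: "X \<in> carrier_mat n l" "X \<noteq> 0\<^sub>m n l" and Y: "Y \<in> carrier_mat m n" "Y \<noteq> 0\<^sub>m m n"
      and M: "M \<in> carrier_mat l m" "M \<noteq> 0\<^sub>m l m"
    have pos: "0 < op_norm p q M * op_norm q r X * op_norm r p Y"
      using op_norm_pos assms(1-3) X Y M by (metis mult_pos_pos)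
    have "norm (mat_trace (X * M * Y)) = norm (mat_trace (M * Y * X))"
      using mat_trace_cyclic[OF M(1) Y(1) X(1)] by simp
    also have "\<dots> \<le> mu_norm TYPE('a) p q r l m n * (op_norm p q M * op_norm q r X * op_norm r p Y)"
      by (rule norm_mat_trace_le_mu_norm[OF assms(1-3) M X Y])
    also have "\<dots> \<le> C * (op_norm p q M * op_norm q r X * op_norm r p Y)"
      using C[OF that] pos by (intro mult_right_mono) auto
    finally show "norm (mat_trace (X * M * Y)) \<le> C * (op_norm q r X * op_norm r p Y * op_norm p q M)"
      by (simp add: ac_simps)
  qed (use that assms in auto)
  then show ?thesis unfolding mu_bounded_def by blast
qed

section \<open>Grothendieck's inequality in terms of operator norms\<close>

lemma sum_norm_sq_col_le:
  fixes X :: "'a::real_normed_field mat"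
  assumes "X \<in> carrier_mat l m" "0 < l" "j < m"
  shows "(\<Sum>i<l. (norm (X $$ (i, j)))\<^sup>2) \<le> (op_norm 1 2 X)\<^sup>2"
proof -
  let ?e = "unit_vec m j :: 'a vec"
  have e: "?e \<noteq> 0\<^sub>v m"
    using assms(3) by (metis index_unit_vec(1) index_zero_vec(1) zero_neq_one)
  have "sqrt (\<Sum>i<l. (norm (X $$ (i, j)))\<^sup>2) = lp_norm 2 (X *\<^sub>v ?e)"
    using assms by (simp add: lp_norm_2)
  also have "\<dots> \<le> op_norm 1 2 X * lp_norm 1 ?e"
    using assms e by (intro lp_norm_mult_mat_vec_le) auto
  also have "lp_norm 1 ?e = 1" using assms by (intro lp_norm_unit_vec) auto
  finally show ?thesis by (simp add: real_sqrt_le_iff sqrt_le_D)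
qed

text \<open>The extremal vector is the conjugate of the row, written as \<open>\<bar>y\<bar>\<^sup>2 / y\<close>.\<close>

lemma sum_norm_sq_row_le:
  fixes Y :: "'a::real_normed_field mat"
  assumes Y: "Y \<in> carrier_mat n l" and k: "k < n"
  shows "(\<Sum>i<l. (norm (Y $$ (k, i)))\<^sup>2) \<le> (op_norm 2 \<infinity> Y)\<^sup>2"
proof -
  define S where "S = (\<Sum>i<l. (norm (Y $$ (k, i)))\<^sup>2)"
  \<comment> \<open>At a zero entry the quotient is 0 as well, so the norms still agree and the
    products with the row need no exception.\<close>
  define x where "x = vec l (\<lambda>i. of_real ((norm (Y $$ (k, i)))\<^sup>2) / Y $$ (k, i))"
  have x: "x \<in> carrier_vec l" by (simp add: x_def)
  have nx: "norm (x $ i) = norm (Y $$ (k, i))" if "i < l" for i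
    using that by (simp add: x_def norm_divide norm_mult power2_eq_square)
  have S0: "0 \<le> S" unfolding S_def by (intro sum_nonneg) auto
  have x2: "lp_norm 2 x = sqrt S" using x nx by (simp add: lp_norm_2 S_def)
  show ?thesis
  proof (cases "x = 0\<^sub>v l")
    case True
    then show ?thesis using nx by simp
  next
    case False
    have "(Y *\<^sub>v x) $ k = (\<Sum>i<l. Y $$ (k, i) * x $ i)"
      using Y k x by (simp add: scalar_prod_def atLeast0LessThan)
    also have "\<dots> = of_real S"
      unfolding S_def of_real_sum by (intro sum.cong) (auto simp: x_def)
    finally have "S = norm ((Y *\<^sub>v x) $ k)" using S0 by simp
    also have "\<dots> \<le> lp_norm \<infinity> (Y *\<^sub>v x)" using Y k by (intro norm_le_lp_norm) auto
    also have "\<dots> \<le> op_norm 2 \<infinity> Y * sqrt S"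
      unfolding x2[symmetric] using Y k x False by (intro lp_norm_mult_mat_vec_le) auto
    finally have "sqrt S * sqrt S \<le> op_norm 2 \<infinity> Y * sqrt S" using S0 by simp
    moreover have "0 < sqrt S" using lp_norm_pos[of 2 x l] x False unfolding x2 by simp
    ultimately have "sqrt S \<le> op_norm 2 \<infinity> Y" by (rule mult_right_le_imp_le)
    then show ?thesis unfolding S_def[symmetric] by (rule sqrt_le_D)
  qed
qed

text \<open>Apply \<open>M\<close> to the vector of the \<open>t k\<close>, whose maximum norm is at
  most 1; the weights \<open>s j\<close> then cannot exceed the l^1 norm of the image.\<close>

lemma cut_norm_bound_op_norm:
  fixes M :: "'a::{real_normed_field, real_inner} mat"
  assumes M: "M \<in> carrier_mat m n" and mn: "0 < m" "0 < n"
  shows "cut_norm_bound m n (\<lambda>j k. M $$ (j, k)) (op_norm \<infinity> 1 M)"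
proof
  fix s t :: "nat \<Rightarrow> 'a"
  assume s: "\<And>j. j < m \<Longrightarrow> norm (s j) \<le> 1" and t: "\<And>k. k < n \<Longrightarrow> norm (t k) \<le> 1"
  define x where "x = vec n t"
  have x: "x \<in> carrier_vec n" by (simp add: x_def)
  have "norm (M $$ (0, 0)) \<le> op_norm \<infinity> 1 M" using M mn by (intro norm_entry_le_op_norm) auto
  then have D: "0 \<le> op_norm \<infinity> 1 M" using norm_ge_zero order_trans by blast
  have "(\<Sum>j<m. \<Sum>k<n. M $$ (j, k) * (s j * t k)) = (\<Sum>j<m. s j * (M *\<^sub>v x) $ j)"
    using M by (simp add: x_def scalar_prod_def atLeast0LessThan sum_distrib_left ac_simps)
  also have "norm \<dots> \<le> (\<Sum>j<m. norm ((M *\<^sub>v x) $ j))"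
    using s by (intro sum_norm_le) (simp add: norm_mult mult_left_le_one_le)
  also have "\<dots> = lp_norm 1 (M *\<^sub>v x)" using M by (simp add: lp_norm_1)
  also have "\<dots> \<le> op_norm \<infinity> 1 M"
  proof (cases "x = 0\<^sub>v n")
    case True
    then have "M *\<^sub>v x = 0\<^sub>v m" using M by auto
    then show ?thesis using D by (simp add: lp_norm_1)
  next
    case False
    have "lp_norm 1 (M *\<^sub>v x) \<le> op_norm \<infinity> 1 M * lp_norm \<infinity> x"
      using M mn x False by (intro lp_norm_mult_mat_vec_le) auto
    also have "lp_norm \<infinity> x \<le> 1"
      using t mn by (auto simp: lp_norm_infinity x_def lessThan_empty_iff intro!: Max.boundedI)
    then have "op_norm \<infinity> 1 M * lp_norm \<infinity> x \<le> op_norm \<infinity> 1 M" using D by (simp add: mult_left_le)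
    finally show ?thesis .
  qed
  finally show "norm (\<Sum>j<m. \<Sum>k<n. M $$ (j, k) * (s j * t k)) \<le> op_norm \<infinity> 1 M" .
qed

text \<open>The trace is the form with coefficients \<open>M\<close>, evaluated at the columns of
  \<open>X\<close> and the rows of \<open>Y\<close>. The norms from l^1 to l^2 and from l^2 to
  l^\<infinity> bound the lengths of these columns and rows.\<close>

lemma mu_bounded_grothendieck: "mu_bounded TYPE('a::{real_normed_field, real_inner}) 1 2 \<infinity>"
proof -
  have "mu_norm TYPE('a) 1 2 \<infinity> l m n \<le> 8" if lmn: "1 \<le> l" "1 \<le> m" "1 \<le> n" for l m n
  proof (rule mu_norm_leI)
    fix X Y M :: "'a mat"
    assume X: "X \<in> carrier_mat l m" "X \<noteq> 0\<^sub>m l m" and Y: "Y \<in> carrier_mat n l" "Y \<noteq> 0\<^sub>m n l"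
      and M: "M \<in> carrier_mat m n" "M \<noteq> 0\<^sub>m m n"
    define a b where "a = op_norm 1 2 X" and "b = op_norm 2 \<infinity> Y"
    have ab: "0 < a" "0 < b"
      using op_norm_pos[OF _ _ X] op_norm_pos[OF _ _ Y] by (simp_all add: a_def b_def)
    interpret cut_norm_bound m n "\<lambda>j k. M $$ (j, k)" "op_norm \<infinity> 1 M"
      using M lmn by (intro cut_norm_bound_op_norm) auto
    have "norm (form l (\<lambda>j i. inverse a *\<^sub>R X $$ (i, j)) (\<lambda>k i. inverse b *\<^sub>R Y $$ (k, i)))
        \<le> 8 * op_norm \<infinity> 1 M"
    proof (rule grothendieck_inequality)
      show "contractive m l (\<lambda>j i. inverse a *\<^sub>R X $$ (i, j))"
        using sum_norm_sq_col_le[OF X(1)] lmn ab(1) unfolding a_def by (intro contractive_normalize) auto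
      show "contractive n l (\<lambda>k i. inverse b *\<^sub>R Y $$ (k, i))"
        using sum_norm_sq_row_le[OF Y(1)] ab(2) unfolding b_def by (intro contractive_normalize) auto
    qed
    moreover have "form l (\<lambda>j i. X $$ (i, j)) (\<lambda>k i. Y $$ (k, i)) = mat_trace (X * M * Y)"
      unfolding form_eq_sum mat_trace_triple[OF X(1) M(1) Y(1)] by (simp add: ac_simps)
    ultimately have "norm (mat_trace (X * M * Y)) \<le> 8 * op_norm \<infinity> 1 M * (a * b)"
      using ab unfolding form_scaleR by (simp add: field_simps)
    then show "norm (mat_trace (X * M * Y))
        \<le> 8 * (op_norm 1 2 X * op_norm 2 \<infinity> Y * op_norm \<infinity> 1 M)"
      by (simp add: a_def b_def ac_simps)
  qed (use lmn in auto)
  then show ?thesis unfolding mu_bounded_def by blast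
qed

subsection \<open>Lower bounds from identity and Hadamard matrices\<close>

lemma powr_growth_le:
  assumes "\<And>k::nat. (2 ^ k) powr \<alpha> \<le> C * (2 ^ k) powr \<beta>"
  shows "\<alpha> \<le> (\<beta>::real)"
proof (rule ccontr)
  assume "\<not> \<alpha> \<le> \<beta>"
  then have "1 < 2 powr (\<alpha> - \<beta>)" by simp
  then obtain k where k: "C < (2 powr (\<alpha> - \<beta>)) ^ k" using real_arch_pow by blast
  have "(2 powr (\<alpha> - \<beta>)) ^ k = (2 ^ k) powr \<alpha> / (2 ^ k) powr \<beta>"
    by (simp add: powr_power powr_powr right_diff_distrib mult.commute flip: powr_realpow powr_diff)
  also have "\<dots> \<le> C" using assms[of k] by (simp add: pos_divide_le_eq)
  finally show False using k by simp
qed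

text \<open>Test matrices of size \<open>2 ^ k\<close> turn uniform boundedness into an inequality
  between exponents, because a constant cannot compensate a larger power of the dimension.\<close>

lemma mu_bounded_growth:
  fixes X Y M :: "nat \<Rightarrow> 'a::real_normed_field mat"
  assumes pqr: "1 \<le> p" "1 \<le> q" "1 \<le> r" and bdd: "mu_bounded TYPE('a) p q r"
    and X: "\<And>k. X k \<in> carrier_mat (2 ^ k) (2 ^ k)" "\<And>k. X k \<noteq> 0\<^sub>m (2 ^ k) (2 ^ k)"
    and Y: "\<And>k. Y k \<in> carrier_mat (2 ^ k) (2 ^ k)" "\<And>k. Y k \<noteq> 0\<^sub>m (2 ^ k) (2 ^ k)"
    and M: "\<And>k. M k \<in> carrier_mat (2 ^ k) (2 ^ k)" "\<And>k. M k \<noteq> 0\<^sub>m (2 ^ k) (2 ^ k)"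
    and le: "\<And>k. op_norm p q (X k) \<le> (2 ^ k) powr x" "\<And>k. op_norm q r (Y k) \<le> (2 ^ k) powr y"
      "\<And>k. op_norm r p (M k) \<le> (2 ^ k) powr z"
    and tr: "\<And>k. norm (mat_trace (X k * M k * Y k)) = (2 ^ k) powr \<alpha>"
  shows "\<alpha> \<le> x + y + z"
proof -
  obtain C where C: "\<And>l m n. 1 \<le> l \<Longrightarrow> 1 \<le> m \<Longrightarrow> 1 \<le> n \<Longrightarrow> mu_norm TYPE('a) p q r l m n \<le> C"
    using bdd unfolding mu_bounded_def by blast
  show ?thesis
  proof (rule powr_growth_le)
    fix k
    define P where "P = op_norm p q (X k) * op_norm q r (Y k) * op_norm r p (M k)"
    have pos: "0 < op_norm p q (X k)" "0 < op_norm q r (Y k)" "0 < op_norm r p (M k)"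
      by (rule op_norm_pos[OF pqr(1,2) X] op_norm_pos[OF pqr(2,3) Y] op_norm_pos[OF pqr(3,1) M])+
    then have P0: "0 \<le> P" by (simp add: P_def)
    have "(2 ^ k) powr \<alpha> \<le> mu_norm TYPE('a) p q r (2 ^ k) (2 ^ k) (2 ^ k) * P"
      unfolding tr[symmetric] P_def by (intro norm_mat_trace_le_mu_norm pqr X Y M)
    \<comment> \<open>The absolute value supplies the nonnegative factor needed when
      \<open>P\<close> is estimated next.\<close>
    also have "\<dots> \<le> \<bar>C\<bar> * P"
      using C[of "2 ^ k" "2 ^ k" "2 ^ k"] P0 by (intro mult_right_mono) auto
    also have "P \<le> (2 ^ k) powr x * (2 ^ k) powr y * (2 ^ k) powr z"
      unfolding P_def using pos le by (intro mult_mono) (auto intro: less_imp_le)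
    then have "\<bar>C\<bar> * P \<le> \<bar>C\<bar> * (2 ^ k) powr (x + y + z)"
      by (intro mult_left_mono) (auto simp: powr_add)
    finally show "(2 ^ k) powr \<alpha> \<le> \<bar>C\<bar> * (2 ^ k) powr (x + y + z)" .
  qed
qed

lemma one_mat_neq_zero: "0 < N \<Longrightarrow> 1\<^sub>m N \<noteq> (0\<^sub>m N N :: 'a::zero_neq_one mat)"
  by (metis index_one_mat(1) index_zero_mat(1) zero_neq_one)

lemma hadamard_mat_neq_zero: "hadamard_mat k \<noteq> (0\<^sub>m (2 ^ k) (2 ^ k) :: 'a::real_normed_field mat)"
proof
  assume "hadamard_mat k = (0\<^sub>m (2 ^ k) (2 ^ k) :: 'a mat)"
  then have "(hadamard_mat k :: 'a mat) $$ (0, 0) = 0" by simp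
  then have "(hadamard k 0 0 :: 'a) = 0" by (simp add: hadamard_mat_def)
  then show False using norm_hadamard[of k 0 0, where 'a = 'a] by simp
qed

lemma op_norm_one_mat_power_le:
  assumes "1 \<le> s" "1 \<le> t"
  shows "op_norm s t (1\<^sub>m (2 ^ k) :: 'a::real_normed_field mat) \<le> (2 ^ k) powr max 0 (recip t - recip s)"
  using op_norm_one_mat_le[OF assms, of "2 ^ k"] by simp

lemma norm_trace_hadamard:
  "norm (mat_trace (hadamard_mat k * hadamard_mat k :: 'a::real_normed_field mat)) = (2 ^ k) powr 2"
  by (simp add: trace_hadamard_square norm_power power_even_eq)

text \<open>The positive parts of the differences around a cycle of three numbers add up to their
  maximum minus their minimum.\<close>

lemma mu_bounded_recip_spread:
  assumes "1 \<le> p" "1 \<le> q" "1 \<le> r" "mu_bounded TYPE('a::real_normed_field) p q r"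
  shows "1 \<le> max 0 (recip q - recip p) + max 0 (recip r - recip q) + max 0 (recip p - recip r)"
proof (rule mu_bounded_growth[where X = "\<lambda>k. 1\<^sub>m (2 ^ k)" and Y = "\<lambda>k. 1\<^sub>m (2 ^ k)"
        and M = "\<lambda>k. 1\<^sub>m (2 ^ k)", OF assms])
  show "norm (mat_trace (1\<^sub>m (2 ^ k) * 1\<^sub>m (2 ^ k) * 1\<^sub>m (2 ^ k) :: 'a mat)) = (2 ^ k) powr 1" for k
    by (simp add: mat_trace_def norm_power)
qed (insert assms one_mat_neq_zero[of "2 ^ k" for k], auto intro: op_norm_one_mat_power_le)

text \<open>Here \<open>M\<close> is a Hadamard matrix of norm at most N^(3/2), where N =
  \<open>2 ^ k\<close>. Taking \<open>X\<close> as the other Hadamard matrix forces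
  \<open>recip q \<ge> 1 / 2\<close>; taking \<open>Y\<close> forces
  \<open>recip q \<le> 1 / 2\<close>.\<close>

lemma mu_bounded_1_infinity:
  assumes q: "1 \<le> q" and bdd: "mu_bounded TYPE('a::{real_normed_field, real_inner}) 1 q \<infinity>"
  shows "q = 2"
proof -
  have M: "op_norm \<infinity> 1 (hadamard_mat k :: 'a mat) \<le> (2 ^ k) powr (3 / 2)" for k
    using op_norm_hadamard_le_euclidean[of \<infinity> 1 k] by simp
  have "2 \<le> recip q + 0 + 3 / 2"
  proof (rule mu_bounded_growth[where X = "\<lambda>k. hadamard_mat k" and Y = "\<lambda>k. 1\<^sub>m (2 ^ k)"
        and M = "\<lambda>k. hadamard_mat k", OF _ q _ bdd])
    show "op_norm 1 q (hadamard_mat k :: 'a mat) \<le> (2 ^ k) powr recip q" for k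
      using op_norm_hadamard_le_entry[of 1 q k] q by simp
    show "op_norm q \<infinity> (1\<^sub>m (2 ^ k) :: 'a mat) \<le> (2 ^ k) powr 0" for k
      using op_norm_one_mat_power_le[of q \<infinity> k] q recip_bounds[OF q] by (simp add: max_absorb1)
    show "norm (mat_trace (hadamard_mat k * hadamard_mat k * 1\<^sub>m (2 ^ k) :: 'a mat)) = (2 ^ k) powr 2" for k
      unfolding right_mult_one_mat[OF mult_carrier_mat[OF hadamard_mat_carrier hadamard_mat_carrier]]
      by (rule norm_trace_hadamard)
  qed (simp_all add: M hadamard_mat_neq_zero one_mat_neq_zero)
  moreover have "2 \<le> 0 + (1 - recip q) + 3 / 2"
  proof (rule mu_bounded_growth[where X = "\<lambda>k. 1\<^sub>m (2 ^ k)" and Y = "\<lambda>k. hadamard_mat k"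
        and M = "\<lambda>k. hadamard_mat k", OF _ q _ bdd])
    show "op_norm q \<infinity> (hadamard_mat k :: 'a mat) \<le> (2 ^ k) powr (1 - recip q)" for k
      using op_norm_hadamard_le_entry[of q \<infinity> k] q by simp
    show "op_norm 1 q (1\<^sub>m (2 ^ k) :: 'a mat) \<le> (2 ^ k) powr 0" for k
      using op_norm_one_mat_power_le[of 1 q k] q recip_bounds[OF q] by (simp add: max_absorb1)
    show "norm (mat_trace (1\<^sub>m (2 ^ k) * hadamard_mat k * hadamard_mat k :: 'a mat)) = (2 ^ k) powr 2" for k
      unfolding left_mult_one_mat[OF hadamard_mat_carrier] by (rule norm_trace_hadamard)
  qed (simp_all add: M hadamard_mat_neq_zero one_mat_neq_zero)
  ultimately have "recip q = recip 2" by simp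
  then show ?thesis using recip_eq_iff[OF q, of 2] by simp
qed

text \<open>Now the Hadamard matrix \<open>M\<close> has norm at most 1. The choice of
  \<open>X\<close> as the second Hadamard matrix forces \<open>recip q \<le> 0\<close>, and that of
  \<open>Y\<close> forces \<open>recip q \<ge> 1\<close>.\<close>

lemma not_mu_bounded_infinity_1:
  assumes q: "1 \<le> q"
  shows "\<not> mu_bounded TYPE('a::{real_normed_field, real_inner}) \<infinity> q 1"
proof
  assume bdd: "mu_bounded TYPE('a) \<infinity> q 1"
  have M: "op_norm 1 \<infinity> (hadamard_mat k :: 'a mat) \<le> 1" for k
    using op_norm_hadamard_le_entry[of 1 \<infinity> k] by simp
  have "2 \<le> (max 0 (recip q - 1 / 2) + 1) + (1 - recip q) + 0"
  proof (rule mu_bounded_growth[where X = "\<lambda>k. hadamard_mat k" and Y = "\<lambda>k. 1\<^sub>m (2 ^ k)"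
        and M = "\<lambda>k. hadamard_mat k", OF _ q _ bdd])
    show "op_norm \<infinity> q (hadamard_mat k :: 'a mat) \<le> (2 ^ k) powr (max 0 (recip q - 1 / 2) + 1)" for k
      using op_norm_hadamard_le_euclidean[of \<infinity> q k] q by (simp add: add.assoc)
    show "op_norm q 1 (1\<^sub>m (2 ^ k) :: 'a mat) \<le> (2 ^ k) powr (1 - recip q)" for k
      using op_norm_one_mat_power_le[of q 1 k] q recip_bounds[OF q] by (simp add: max_absorb2)
    show "norm (mat_trace (hadamard_mat k * hadamard_mat k * 1\<^sub>m (2 ^ k) :: 'a mat)) = (2 ^ k) powr 2" for k
      unfolding right_mult_one_mat[OF mult_carrier_mat[OF hadamard_mat_carrier hadamard_mat_carrier]]
      by (rule norm_trace_hadamard)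
  qed (simp_all add: M hadamard_mat_neq_zero one_mat_neq_zero)
  moreover have "2 \<le> recip q + (1 + max 0 (1 / 2 - recip q)) + 0"
  proof (rule mu_bounded_growth[where X = "\<lambda>k. 1\<^sub>m (2 ^ k)" and Y = "\<lambda>k. hadamard_mat k"
        and M = "\<lambda>k. hadamard_mat k", OF _ q _ bdd])
    show "op_norm q 1 (hadamard_mat k :: 'a mat) \<le> (2 ^ k) powr (1 + max 0 (1 / 2 - recip q))" for k
      using op_norm_hadamard_le_euclidean[of q 1 k] q by simp
    show "op_norm \<infinity> q (1\<^sub>m (2 ^ k) :: 'a mat) \<le> (2 ^ k) powr recip q" for k
      using op_norm_one_mat_power_le[of \<infinity> q k] q recip_bounds[OF q] by (simp add: max_absorb2)
    show "norm (mat_trace (1\<^sub>m (2 ^ k) * hadamard_mat k * hadamard_mat k :: 'a mat)) = (2 ^ k) powr 2" for k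
      unfolding left_mult_one_mat[OF hadamard_mat_carrier] by (rule norm_trace_hadamard)
  qed (simp_all add: M hadamard_mat_neq_zero one_mat_neq_zero)
  ultimately show False by (auto simp: max_def split: if_splits)
qed

lemma mu_bounded_iff:
  assumes p: "1 \<le> p" and q: "1 \<le> q" and r: "1 \<le> r"
  shows "mu_bounded TYPE('a::{real_normed_field, real_inner}) p q r
    \<longleftrightarrow> (p, q, r) \<in> {(1, 2, \<infinity>), (\<infinity>, 1, 2), (2, \<infinity>, 1)}"
proof
  assume pqr: "mu_bounded TYPE('a) p q r"
  have qrp: "mu_bounded TYPE('a) q r p" using mu_bounded_cyclic[OF p q r pqr] .
  have rpq: "mu_bounded TYPE('a) r p q" using mu_bounded_cyclic[OF q r p qrp] .
  note b = recip_bounds[OF p] recip_bounds[OF q] recip_bounds[OF r]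
  note s = mu_bounded_recip_spread[OF p q r pqr]
  have one: "recip s = 1 \<Longrightarrow> s = 1" and zero: "recip s = 0 \<Longrightarrow> s = \<infinity>" if "1 \<le> s" for s
    using recip_eq_iff[OF that, of 1] recip_eq_iff[OF that, of \<infinity>] by simp_all
  \<comment> \<open>Reciprocals in [0, 1] with spread at least 1 include both 1 and 0. Cases 1, 4, 5
    are the cyclic shifts of \<open>(\<infinity>, _, 1)\<close>, which are impossible; cases 2, 3, 6
    are those of \<open>(1, _, \<infinity>)\<close>.\<close>
  consider "recip p = 1" "recip q = 0" | "recip p = 1" "recip r = 0"
    | "recip q = 1" "recip p = 0" | "recip q = 1" "recip r = 0"
    | "recip r = 1" "recip p = 0" | "recip r = 1" "recip q = 0"
    using b s by (smt (verit))
  then show "(p, q, r) \<in> {(1, 2, \<infinity>), (\<infinity>, 1, 2), (2, \<infinity>, 1)}"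
  proof cases
    case 1
    then have "mu_bounded TYPE('a) \<infinity> r 1" using qrp one[OF p] zero[OF q] by simp
    then show ?thesis using not_mu_bounded_infinity_1[OF r] by blast
  next
    case 2
    then have pr: "p = 1" "r = \<infinity>" using one[OF p] zero[OF r] by simp_all
    then show ?thesis using mu_bounded_1_infinity[OF q] pqr by simp
  next
    case 3
    then have pq: "q = 1" "p = \<infinity>" using one[OF q] zero[OF p] by simp_all
    then show ?thesis using mu_bounded_1_infinity[OF r] qrp by simp
  next
    case 4
    then have "mu_bounded TYPE('a) \<infinity> p 1" using rpq one[OF q] zero[OF r] by simp
    then show ?thesis using not_mu_bounded_infinity_1[OF p] by blast
  next
    case 5
    then have "mu_bounded TYPE('a) \<infinity> q 1" using pqr one[OF r] zero[OF p] by simp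
    then show ?thesis using not_mu_bounded_infinity_1[OF q] by blast
  next
    case 6
    then have qr: "r = 1" "q = \<infinity>" using one[OF r] zero[OF q] by simp_all
    then show ?thesis using mu_bounded_1_infinity[OF p] rpq by simp
  qed
next
  have 1: "mu_bounded TYPE('a) 1 2 \<infinity>" by (rule mu_bounded_grothendieck)
  have 2: "mu_bounded TYPE('a) 2 \<infinity> 1" by (rule mu_bounded_cyclic[OF _ _ _ 1]) simp_all
  have 3: "mu_bounded TYPE('a) \<infinity> 1 2" by (rule mu_bounded_cyclic[OF _ _ _ 2]) simp_all
  assume "(p, q, r) \<in> {(1, 2, \<infinity>), (\<infinity>, 1, 2), (2, \<infinity>, 1)}"
  then show "mu_bounded TYPE('a) p q r" using 1 2 3 by auto
qed

theorem theorem5p2: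
  fixes p q r :: ereal
  assumes "1 \<le> p" "1 \<le> q" "1 \<le> r"
  shows "((SUP (l, m, n) \<in> {1..} \<times> {1..} \<times> {1..}. ereal (mu_norm TYPE(real) p q r l m n)) < \<infinity>
            \<longleftrightarrow> (p, q, r) \<in> {(1, 2, \<infinity>), (\<infinity>, 1, 2), (2, \<infinity>, 1)})
       \<and> ((SUP (l, m, n) \<in> {1..} \<times> {1..} \<times> {1..}. ereal (mu_norm TYPE(complex) p q r l m n)) < \<infinity>
            \<longleftrightarrow> (p, q, r) \<in> {(1, 2, \<infinity>), (\<infinity>, 1, 2), (2, \<infinity>, 1)})"
  unfolding SUP_mu_norm_less_infinity_iff
  using mu_bounded_iff[OF assms, where 'a = real] mu_bounded_iff[OF assms, where 'a = complex] by blast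

end
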